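(* Let $p$ be a prime, let $L,R\ge 1$ be integers, and let $c_{-L},\dots,c_R\in\mathbb{F}_p$ with $c_{-L}\neq 0$ and $c_R\neq 0$. Let $M$ be the $n\times n$ banded Toeplitz matrix with parameters $c_{-L},\dots,c_R$, assume $M$ is invertible, and let $B_{i,j}$ be the blocks of $M^{-1}$ of size $P(f)\times P(f)$. Then for all $1\le i<j\le\lfloor n/P(f)\rfloor$ one has $B_{i,j}=B_{1,2}$. Moreover, if $P(f)\nmid n$, then for all $1\le i\le\lfloor n/P(f)\rfloor$ the block $B_{i,\lceil n/P(f)\rceil}$ is equal to the submatrix formed by the left $(n \bmod P(f))$ columns of $B_{1,2}$.
   Context: The banded Toeplitz matrix $M$ of order $n$ with parameters $c_{-L},\dots,c_R$ is the $n\times n$ matrix whose $(i,j)$ entry is $c_{j-i}$ if $-L\le j-i\le R$ and $0$ otherwise. The associated polynomial is $f(x)=c_R x^{L+R}+\cdots+c_{-L+1}x+c_{-L}\in\mathbb{F}_p[x]$, and its period is $P(f)=\min\{q\in\mathbb{Z}_{>0} : f(x)\mid x^q-1 \text{ in } \mathbb{F}_p[x]\}$. Block partition: starting from the top-left corner, $M^{-1}$ is partitioned into blocks $B_{i,j}$, $1\le i,j\le\lceil n/P(f)\rceil$, of size $P(f)\times P(f)$, where $B_{i,j}$ consists of rows $(i-1)P(f)+1,\dots,\min(iP(f),n)$ and columns $(j-1)P(f)+1,\dots,\min(jP(f),n)$ (so the last block row and column are smaller if $P(f)\nmid n$). *)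

theory Defs
  imports
    Complex_Main
    "Berlekamp_Zassenhaus.Finite_Field"
    "Jordan_Normal_Form.DL_Submatrix"
begin

text \<open>
  The parameters $c_{-L},\dots,c_R$ are given by a function on the integers of which only the
  values at \<open>-L, \<dots>, R\<close> are used.
  Entries of matrices are indexed from 0, which does not affect \<open>j - i\<close>.
\<close>

definition banded_toeplitz ::
    "nat \<Rightarrow> nat \<Rightarrow> nat \<Rightarrow> (int \<Rightarrow> 'a::zero) \<Rightarrow> 'a mat" where
  "banded_toeplitz n L R c = mat n n (\<lambda>(i, j).
     if - int L \<le> int j - int i \<and> int j - int i \<le> int R then c (int j - int i) else 0)"

definition toeplitz_poly :: "nat \<Rightarrow> nat \<Rightarrow> (int \<Rightarrow> 'a::comm_monoid_add) \<Rightarrow> 'a poly" where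
  "toeplitz_poly L R c = (\<Sum>k = 0..L + R. monom (c (int k - int L)) k)"

text \<open>
  Over a finite field, a \<open>q\<close> as below exists whenever the constant coefficient of \<open>f\<close> is nonzero.
\<close>

definition poly_period :: "'a::field poly \<Rightarrow> nat" where
  "poly_period f = (LEAST q. 0 < q \<and> f dvd monom 1 q - 1)"

text \<open>
  Blocks are numbered from 1. In 0-based indices, the rows
  \<open>(i - 1) * s + 1, \<dots>, min (i * s) n\<close> are \<open>{(i - 1) * s..<min (i * s) n}\<close>.
\<close>

definition mat_block :: "nat \<Rightarrow> 'a mat \<Rightarrow> nat \<Rightarrow> nat \<Rightarrow> 'a mat" where
  "mat_block s A i j = submatrix A
     {(i - 1) * s..<min (i * s) (dim_row A)} {(j - 1) * s..<min (j * s) (dim_col A)}"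

definition left_columns :: "nat \<Rightarrow> 'a mat \<Rightarrow> 'a mat" where
  "left_columns m A = submatrix A {..<dim_row A} {..<m}"

end

theory Submission
  imports Defs
begin

text \<open>
  Let \<open>X\<close> be the inverse of \<open>M\<close> and let \<open>g * f = x ^ P - 1\<close>, so that \<open>g\<close> has degree
  \<open>P - L - R\<close>. Multiplying a row vector, read as a polynomial \<open>h\<close> of degree below \<open>n\<close>, by \<open>M\<close>
  yields the coefficients of \<open>h * f\<close> from \<open>L\<close> on. Hence \<open>x ^ (i + L) * g\<close> is mapped to the
  difference of the unit vectors \<open>i + P\<close> and \<open>i\<close>, that is, it is the difference of the rows
  \<open>i + P\<close> and \<open>i\<close> of \<open>X\<close>. Its degree is below \<open>i + P\<close>, so these rows agree from column
  \<open>i + P\<close> on. Since \<open>X\<close> is symmetric about its antidiagonal, as \<open>M\<close> is, columns behave likewise.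
\<close>

section \<open>Existence of the period over a finite field\<close>

lemma dvd_X_power_mult_cancel:
  fixes f h :: "'a::field poly"
  assumes "coeff f 0 \<noteq> 0" and "f dvd monom 1 a * h"
  shows "f dvd h"
  using assms(2)
proof (induction a)
  case 0
  then show ?case by (simp flip: one_pCons add: monom_0)
next
  case (Suc a)
  from Suc.prems obtain k where k: "monom 1 (Suc a) * h = f * k" by (rule dvdE)
  obtain k0 k' where k': "k = pCons k0 k'" by (cases k)
  have shift: "pCons 0 (monom 1 a * h) = f * k"
    using k by (simp add: monom_Suc)
  then have "coeff (f * k) 0 = 0" by (metis coeff_pCons_0)
  \<comment> \<open>The constant coefficient of \<open>f * k\<close> is
    \<open>coeff f 0 * k0\<close>, so the cofactor is itself divisible by x and one factor x
    cancels.\<close>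
  then have "k0 = 0" using assms(1) k' by (simp add: coeff_mult)
  then have "pCons 0 (monom 1 a * h) = pCons 0 (f * k')"
    using shift k' by simp
  then have "f dvd monom 1 a * h" by simp
  then show ?case by (rule Suc.IH)
qed

lemma finite_degree_less: "finite {q :: 'a::{zero,finite} poly. degree q < d}"
proof (rule finite_subset)
  show "{q :: 'a poly. degree q < d} \<subseteq> Poly ` {xs. set xs \<subseteq> UNIV \<and> length xs \<le> d}"
  proof
    fix q :: "'a poly" assume "q \<in> {q. degree q < d}"
    then have "length (coeffs q) \<le> d" by (auto simp: length_coeffs_degree coeffs_def)
    then show "q \<in> Poly ` {xs. set xs \<subseteq> UNIV \<and> length xs \<le> d}"
      by (intro image_eqI[of _ _ "coeffs q"]) auto
  qed
  show "finite (Poly ` {xs :: 'a list. set xs \<subseteq> UNIV \<and> length xs \<le> d})"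
    by (intro finite_imageI finite_lists_length_le) simp
qed

text \<open>Pigeonhole: the powers of x leave finitely many remainders modulo \<open>f\<close>, so
  two of them agree. Their difference is \<open>monom 1 a\<close> times
  \<open>monom 1 (b - a) - 1\<close>, and the power of x cancels because \<open>f\<close> has
  nonzero constant coefficient.\<close>

lemma poly_period:
  fixes f :: "'a::{field_gcd,finite} poly"
  assumes "coeff f 0 \<noteq> 0"
  shows "0 < poly_period f" and "f dvd monom 1 (poly_period f) - 1"
proof -
  have f0: "f \<noteq> 0" using assms by auto
  let ?r = "\<lambda>k. monom (1::'a) k mod f"
  \<comment> \<open>The bound is \<open>Suc (degree f)\<close> because for constant \<open>f\<close>
    the remainder 0 has degree 0, which is not below \<open>degree f\<close>.\<close>
  have "degree (?r k) < Suc (degree f)" for k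
    using degree_mod_less[OF f0, of "monom 1 k"] by auto
  then have "range ?r \<subseteq> {q. degree q < Suc (degree f)}" by auto
  then have "finite (range ?r)" using finite_degree_less finite_subset by blast
  then have "\<not> inj ?r" using finite_imageD infinite_UNIV_nat by blast
  then obtain a b where ab: "a < b" "?r a = ?r b"
    by (auto simp: inj_def) (metis linorder_neqE_nat)
  then have "f dvd monom 1 b - monom 1 a" by (metis mod_eq_dvd_iff)
  also have "monom 1 b - monom 1 a = monom (1::'a) a * (monom 1 (b - a) - 1)"
    using ab(1) by (simp add: algebra_simps mult_monom)
  finally have "f dvd monom 1 (b - a) - 1" by (rule dvd_X_power_mult_cancel[OF assms])
  then have "0 < b - a \<and> f dvd monom 1 (b - a) - 1" using ab(1) by simp
  then have "0 < poly_period f \<and> f dvd monom 1 (poly_period f) - 1"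
    unfolding poly_period_def by (rule LeastI)
  then show "0 < poly_period f" and "f dvd monom 1 (poly_period f) - 1" by auto
qed

section \<open>Multiplication by the matrix as multiplication by the polynomial\<close>

lemma coeff_toeplitz_poly:
  "coeff (toeplitz_poly L R c) m = (if m \<le> L + R then c (int m - int L) else 0)"
  by (simp add: toeplitz_poly_def coeff_sum)

lemma degree_toeplitz_poly:
  assumes "c (int R) \<noteq> 0"
  shows "degree (toeplitz_poly L R c) = L + R"
proof (rule antisym)
  show "degree (toeplitz_poly L R c) \<le> L + R"
    by (rule degree_le) (simp add: coeff_toeplitz_poly)
  show "L + R \<le> degree (toeplitz_poly L R c)"
    using assms by (intro le_degree) (simp add: coeff_toeplitz_poly)
qed

lemma degree_eq_period_cofactor:
  fixes f g :: "'a::field poly"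
  assumes "f * g = monom 1 P - 1" and "0 < P"
  shows "degree f + degree g = P" and "g \<noteq> 0"
proof -
  have deg: "degree (monom (1::'a) P - 1) = P"
    using assms(2) degree_add_eq_left[of "- 1" "monom (1::'a) P"]
    by (simp add: degree_monom_eq)
  with assms have nz: "f * g \<noteq> 0" by (metis degree_0 less_irrefl)
  then show "g \<noteq> 0" by auto
  show "degree f + degree g = P" using deg nz assms(1) by (metis degree_mult_eq mult_zero_left mult_zero_right)
qed

text \<open>The guard is the lower edge of the band, where subtraction on naturals would truncate;
  at the upper edge the coefficient vanishes by itself.\<close>

lemma banded_toeplitz_index:
  assumes "k < n" and "j < n"
  shows "banded_toeplitz n L R c $$ (k, j) =
    (if k \<le> j + L then coeff (toeplitz_poly L R c) (j + L - k) else 0)"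
  using assms by (auto simp: banded_toeplitz_def coeff_toeplitz_poly of_nat_diff algebra_simps)

lemma sum_coeff_mult_banded_toeplitz:
  fixes c :: "int \<Rightarrow> 'a::comm_ring_1"
  assumes "degree h < n" and "j < n"
  shows "(\<Sum>k<n. coeff h k * banded_toeplitz n L R c $$ (k, j)) =
    coeff (h * toeplitz_poly L R c) (j + L)"
proof -
  let ?f = "toeplitz_poly L R c"
  let ?t = "\<lambda>k. if k \<le> j + L then coeff h k * coeff ?f (j + L - k) else 0"
  have "(\<Sum>k<n. coeff h k * banded_toeplitz n L R c $$ (k, j)) = sum ?t {..<n}"
    using assms(2) by (intro sum.cong) (auto simp: banded_toeplitz_index)
  \<comment> \<open>The range is first enlarged beyond both \<open>n\<close> and
    \<open>j + L\<close>, adding only zeros as \<open>degree h < n\<close>; the guard then cuts it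
    to the convolution range.\<close>
  also have "\<dots> = sum ?t {..<n + j + L + 1}"
    using assms(1) by (intro sum.mono_neutral_left) (auto simp: coeff_eq_0)
  also have "\<dots> = sum ?t {..j + L}"
    by (intro sum.mono_neutral_right) auto
  also have "\<dots> = coeff (h * ?f) (j + L)"
    by (simp add: coeff_mult)
  finally show ?thesis .
qed

text \<open>For row vectors, uM = v gives u = uMX = vX.\<close>

lemma vec_eq_sum_right_inverse:
  fixes M X :: "'a::comm_ring_1 mat"
  assumes M: "M \<in> carrier_mat n n" and X: "X \<in> carrier_mat n n" and inv: "inverts_mat M X"
    and uM: "\<And>j. j < n \<Longrightarrow> (\<Sum>k<n. u k * M $$ (k, j)) = v j" and l: "l < n"
  shows "u l = (\<Sum>j<n. v j * X $$ (j, l))"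
proof -
  have MX: "(\<Sum>j<n. M $$ (k, j) * X $$ (j, l)) = (if k = l then 1 else 0)" if "k < n" for k
  proof -
    have "(M * X) $$ (k, l) = (if k = l then 1 else 0)"
      using inv M that l by (simp add: inverts_mat_def)
    then show ?thesis
      using M X that l by (simp add: scalar_prod_def atLeast0LessThan)
  qed
  have "(\<Sum>j<n. v j * X $$ (j, l)) = (\<Sum>j<n. \<Sum>k<n. u k * (M $$ (k, j) * X $$ (j, l)))"
    by (intro sum.cong) (auto simp: uM[symmetric] sum_distrib_right mult.assoc)
  also have "\<dots> = (\<Sum>k<n. u k * (\<Sum>j<n. M $$ (k, j) * X $$ (j, l)))"
    by (subst sum.swap) (simp add: sum_distrib_left)
  also have "\<dots> = (\<Sum>k<n. if k = l then u k else 0)"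
    by (intro sum.cong) (auto simp: MX)
  also have "\<dots> = u l" using l by simp
  finally show ?thesis by simp
qed

section \<open>Periodicity and symmetry of the inverse\<close>

lemma toeplitz_inverse_row_period:
  fixes c :: "int \<Rightarrow> 'a::field"
  assumes L: "1 \<le> L" and R: "1 \<le> R" and cR: "c (int R) \<noteq> 0"
    and X: "X \<in> carrier_mat n n" and inv: "inverts_mat (banded_toeplitz n L R c) X"
    and P: "0 < P" "toeplitz_poly L R c dvd monom 1 P - 1"
    and b: "i + P \<le> b" "b < n"
  shows "X $$ (i + P, b) = X $$ (i, b)"
proof -
  let ?f = "toeplitz_poly L R c"
  obtain g where g: "?f * g = monom 1 P - 1" using P(2) by (metis dvdE)
  note deg = degree_eq_period_cofactor[OF g P(1)]
  define h where "h = monom 1 (i + L) * g"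
  have dh: "degree h = i + L + degree g"
    unfolding h_def using deg(2) by (subst degree_mult_eq) (auto simp: degree_monom_eq)
  \<comment> \<open>The degree is \<open>i + P - R\<close>, so \<open>R \<ge> 1\<close> makes the
    bound strict; the coefficients of \<open>h\<close> vanish from \<open>i + P\<close> on.\<close>
  then have less: "degree h < i + P" using deg(1) R by (simp add: degree_toeplitz_poly cR)
  have "h * ?f = monom 1 (i + L) * (?f * g)" by (simp add: h_def mult.commute mult.left_commute)
  also have "\<dots> = monom 1 (i + P + L) - monom 1 (i + L)"
    unfolding g by (simp add: algebra_simps mult_monom)
  finally have hf: "h * ?f = monom 1 (i + P + L) - monom 1 (i + L)" .
  have M: "banded_toeplitz n L R c \<in> carrier_mat n n" by (simp add: banded_toeplitz_def)
  let ?v = "\<lambda>j. (if j = i + P then 1 else 0) - (if j = i then 1 else 0)"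
  have "(\<Sum>k<n. coeff h k * banded_toeplitz n L R c $$ (k, j)) = ?v j" if "j < n" for j
    using sum_coeff_mult_banded_toeplitz[of h n j L R c] less b that by (auto simp: hf)
  then have "coeff h b = (\<Sum>j<n. ?v j * X $$ (j, b))"
    using b(2) by (intro vec_eq_sum_right_inverse[OF M X inv, of "coeff h" ?v])
  also have "\<dots> = X $$ (i + P, b) - X $$ (i, b)"
    using b by (simp add: left_diff_distrib sum_subtractf if_distrib[of "\<lambda>x. x * _"] cong: if_cong)
  finally show ?thesis using less b by (simp add: coeff_eq_0)
qed

text \<open>Reflection in the antidiagonal reverses products and fixes M. It turns XM = 1 into MY =
  1 for the reflection Y of X, and inverses are unique.\<close>

lemma toeplitz_inverse_persymmetric:
  fixes c :: "int \<Rightarrow> 'a::comm_ring_1"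
  assumes X: "X \<in> carrier_mat n n"
    and inv: "inverts_mat (banded_toeplitz n L R c) X" "inverts_mat X (banded_toeplitz n L R c)"
    and ij: "i < n" "j < n"
  shows "X $$ (i, j) = X $$ (n - 1 - j, n - 1 - i)"
proof -
  let ?M = "banded_toeplitz n L R c"
  have M: "?M \<in> carrier_mat n n" by (simp add: banded_toeplitz_def)
  have persym: "?M $$ (k, l) = ?M $$ (n - 1 - l, n - 1 - k)" if "k < n" "l < n" for k l
    using that by (simp add: banded_toeplitz_def of_nat_diff)
  define Y where "Y = mat n n (\<lambda>(i, j). X $$ (n - 1 - j, n - 1 - i))"
  have Y: "Y \<in> carrier_mat n n" by (simp add: Y_def)
  have "?M * Y = 1\<^sub>m n"
  proof (rule eq_matI)
    fix k l assume "k < dim_row (1\<^sub>m n)" "l < dim_col (1\<^sub>m n)"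
    then have kl: "k < n" "l < n" by auto
    have "(?M * Y) $$ (k, l) = (\<Sum>m<n. ?M $$ (k, m) * X $$ (n - 1 - l, n - 1 - m))"
      using M Y kl by (simp add: scalar_prod_def atLeast0LessThan Y_def)
    also have "\<dots> = (\<Sum>m<n. X $$ (n - 1 - l, n - 1 - m) * ?M $$ (n - 1 - m, n - 1 - k))"
      using kl by (intro sum.cong) (auto simp: persym[of k] mult.commute)
    also have "\<dots> = (\<Sum>m<n. X $$ (n - 1 - l, m) * ?M $$ (m, n - 1 - k))"
      using sum.nat_diff_reindex[of "\<lambda>m. X $$ (n - 1 - l, m) * ?M $$ (m, n - 1 - k)" n] by simp
    also have "\<dots> = (X * ?M) $$ (n - 1 - l, n - 1 - k)"
      using M X kl by (simp add: scalar_prod_def atLeast0LessThan)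
    also have "\<dots> = 1\<^sub>m n $$ (k, l)"
      using inv(2) X kl by (auto simp: inverts_mat_def)
    finally show "(?M * Y) $$ (k, l) = 1\<^sub>m n $$ (k, l)" .
  qed (use M Y in auto)
  then have "X = X * (?M * Y)" using X by simp
  also have "\<dots> = (X * ?M) * Y" using X M Y by (simp add: assoc_mult_mat)
  also have "\<dots> = Y" using inv(2) X Y by (simp add: inverts_mat_def)
  finally have "X $$ (i, j) = Y $$ (i, j)" by simp
  then show ?thesis using ij by (simp add: Y_def)
qed

lemma toeplitz_inverse_column_period:
  fixes c :: "int \<Rightarrow> 'a::field"
  assumes "1 \<le> L" and "1 \<le> R" and "c (int R) \<noteq> 0"
    and X: "X \<in> carrier_mat n n"
    and inv: "inverts_mat (banded_toeplitz n L R c) X" "inverts_mat X (banded_toeplitz n L R c)"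
    and "0 < P" "toeplitz_poly L R c dvd monom 1 P - 1"
    and ab: "a \<le> b" "b + P < n"
  shows "X $$ (a, b + P) = X $$ (a, b)"
proof -
  \<comment> \<open>The reflection takes columns \<open>b + P\<close> and \<open>b\<close> to rows
    \<open>?i\<close> and \<open>?i + P\<close>, and \<open>a \<le> b\<close> becomes the condition
    \<open>?i + P \<le> n - 1 - a\<close> of the row case.\<close>
  let ?i = "n - 1 - (b + P)"
  have i: "?i + P = n - 1 - b" using ab by simp
  have "X $$ (a, b + P) = X $$ (?i, n - 1 - a)"
    using ab by (intro toeplitz_inverse_persymmetric[OF X inv]) auto
  also have "\<dots> = X $$ (?i + P, n - 1 - a)"
    using assms ab by (intro toeplitz_inverse_row_period[symmetric, of L R c]) auto
  also have "\<dots> = X $$ (a, b)"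
    unfolding i using ab by (intro toeplitz_inverse_persymmetric[OF X inv, symmetric]) auto
  finally show ?thesis .
qed

text \<open>Row steps lead up to the first block row, then column steps lead left to the second
  block column. Every entry on the way stays in the region where the periods hold.\<close>

lemma toeplitz_inverse_upper_period:
  fixes c :: "int \<Rightarrow> 'a::field"
  assumes "1 \<le> L" and "1 \<le> R" and "c (int R) \<noteq> 0"
    and "X \<in> carrier_mat n n"
    and "inverts_mat (banded_toeplitz n L R c) X" "inverts_mat X (banded_toeplitz n L R c)"
    and "0 < P" "toeplitz_poly L R c dvd monom 1 P - 1"
    and r: "r < P" and uv: "u \<le> v" and b: "Suc v * P + s < n"
  shows "X $$ (u * P + r, Suc v * P + s) = X $$ (r, P + s)"
proof -
  have "X $$ (w * P + r, Suc v * P + s) = X $$ (r, Suc v * P + s)" if "w \<le> v" for w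
    using that
  proof (induction w)
    case (Suc w)
    \<comment> \<open>The lower of the two rows compared must not pass the column index;
      \<open>Suc w \<le> v\<close> and \<open>r < P\<close> ensure this.\<close>
    have "Suc w * P + r \<le> Suc v * P + s"
      using Suc.prems r mult_le_mono1[of "Suc w" v P] by simp
    then have "X $$ (w * P + r + P, Suc v * P + s) = X $$ (w * P + r, Suc v * P + s)"
      using assms by (intro toeplitz_inverse_row_period[of L R c]) auto
    then show ?case using Suc by (simp add: add_ac)
  qed simp
  moreover have "X $$ (r, Suc w * P + s) = X $$ (r, P + s)" if "w \<le> v" for w
    using that
  proof (induction w)
    case (Suc w)
    have "Suc (Suc w) * P + s < n"
      using Suc.prems b mult_le_mono1[of "Suc w" v P] by simp
    then have "X $$ (r, Suc w * P + s + P) = X $$ (r, Suc w * P + s)"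
      using assms by (intro toeplitz_inverse_column_period[of L R c]) auto
    then show ?case using Suc by (simp add: add_ac)
  qed simp
  ultimately show ?thesis using uv by simp
qed

section \<open>Blocks as index intervals and their comparison\<close>

lemma pick_interval:
  assumes "a + k < b"
  shows "pick {a..<b} k = a + k"
proof -
  \<comment> \<open>Exactly \<open>k\<close> elements of the interval precede \<open>a + k\<close>,
    and \<open>pick\<close> enumerates by this rank.\<close>
  have "{x \<in> {a..<b}. x < a + k} = {a..<a + k}" using assms by auto
  then show ?thesis using pick_card_in_set[of "a + k" "{a..<b}"] assms by simp
qed

lemma submatrix_interval:
  assumes "b \<le> dim_row A" and "d \<le> dim_col A"
  shows "submatrix A {a..<b} {e..<d} = mat (b - a) (d - e) (\<lambda>(i, j). A $$ (a + i, e + j))"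
proof -
  have "{i. i < dim_row A \<and> i \<in> {a..<b}} = {a..<b}" "{j. j < dim_col A \<and> j \<in> {e..<d}} = {e..<d}"
    using assms by auto
  then show ?thesis by (intro eq_matI) (auto simp: submatrix_def pick_interval)
qed

text \<open>The right-hand side depends on \<open>i\<close> not at all and on \<open>j\<close> only
  through the width, which the minimum keeps correct for a truncated last block.\<close>

lemma mat_block_toeplitz_inverse:
  fixes c :: "int \<Rightarrow> 'a::field"
  assumes hyps: "1 \<le> L" "1 \<le> R" "c (int R) \<noteq> 0"
    "X \<in> carrier_mat n n"
    "inverts_mat (banded_toeplitz n L R c) X" "inverts_mat X (banded_toeplitz n L R c)"
    "0 < P" "toeplitz_poly L R c dvd monom 1 P - 1"
    and ij: "1 \<le> i" "i < j" and iP: "i * P \<le> n"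
  shows "mat_block P X i j =
    mat P (min (j * P) n - (j - 1) * P) (\<lambda>(r, s). X $$ (r, P + s))"
proof -
  have dims: "dim_row X = n" "dim_col X = n" using hyps(4) by auto
  \<comment> \<open>Passing to 0-based block indices: row block \<open>u\<close>, column block
    \<open>Suc v\<close>.\<close>
  obtain u v where uv: "i = Suc u" "j = Suc (Suc v)" "u \<le> v"
    using ij by (metis Suc_le_D Suc_less_eq2 One_nat_def less_Suc_eq_le)
  have "mat_block P X i j = mat (i * P - (i - 1) * P) (min (j * P) n - (j - 1) * P)
      (\<lambda>(r, s). X $$ ((i - 1) * P + r, (j - 1) * P + s))"
    unfolding mat_block_def dims using iP by (subst submatrix_interval) (auto simp: dims min_absorb1)
  also have "\<dots> = mat P (min (j * P) n - (j - 1) * P) (\<lambda>(r, s). X $$ (r, P + s))"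
  proof (rule eq_matI, goal_cases)
    case (1 r s)
    then have "r < P" "Suc v * P + s < n" "s < min (j * P) n - (j - 1) * P"
      by (auto simp: uv)
    then show ?case
      using toeplitz_inverse_upper_period[OF hyps, of r u v s] 1 by (simp add: uv)
  qed (auto simp: uv)
  finally show ?thesis .
qed

theorem theorem8:
  fixes c :: "int \<Rightarrow> 'p::prime_card mod_ring"
    and L R n P :: nat
    and M Minv :: "'p mod_ring mat"
  assumes "1 \<le> L" and "1 \<le> R"
    and "c (- int L) \<noteq> 0" and "c (int R) \<noteq> 0"
    and "M = banded_toeplitz n L R c"
    and "invertible_mat M"
    and "Minv \<in> carrier_mat n n" and "inverts_mat M Minv" and "inverts_mat Minv M"
    and "P = poly_period (toeplitz_poly L R c)"
  shows "(\<forall>i j. 1 \<le> i \<and> i < j \<and> j \<le> nat \<lfloor>real n / real P\<rfloor> \<longrightarrow>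
            mat_block P Minv i j = mat_block P Minv 1 2) \<and>
         (\<not> P dvd n \<longrightarrow>
            (\<forall>i. 1 \<le> i \<and> i \<le> nat \<lfloor>real n / real P\<rfloor> \<longrightarrow>
              mat_block P Minv i (nat \<lceil>real n / real P\<rceil>) =
              left_columns (n mod P) (mat_block P Minv 1 2)))"
proof -
  let ?f = "toeplitz_poly L R c"
  have "coeff ?f 0 \<noteq> 0" using assms(3) by (simp add: coeff_toeplitz_poly)
  then have P: "0 < P" "?f dvd monom 1 P - 1" unfolding assms(10) by (rule poly_period)+
  note block = mat_block_toeplitz_inverse[OF assms(1,2,4,7) assms(8,9)[unfolded assms(5)] P]
  have floor: "nat \<lfloor>real n / real P\<rfloor> = n div P"
    by (simp add: floor_divide_of_nat_eq)
  have le: "i * P \<le> n" if "i \<le> n div P" for i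
    using that P(1) by (simp add: less_eq_div_iff_mult_less_eq)
  show ?thesis unfolding floor
  proof (intro conjI allI impI; (elim conjE)?)
    fix i j assume ij: "1 \<le> i" "i < j" "j \<le> n div P"
    have "i * P \<le> n" "j * P \<le> n" "1 * P \<le> n" "2 * P \<le> n"
      using ij by (intro le; simp)+
    moreover have "j * P - (j - 1) * P = P" using ij by (cases j) auto
    ultimately show "mat_block P Minv i j = mat_block P Minv 1 2"
      using ij block[of i j] block[of 1 2] by (simp add: min_absorb1)
  next
    fix i assume nd: "\<not> P dvd n" and i: "1 \<le> i" "i \<le> n div P"
    let ?q = "n div P"
    have n: "?q * P + n mod P = n" by simp
    have mod: "n mod P < P" "0 < n mod P" using P(1) nd by (auto simp: dvd_eq_mod_eq_0)
    have "\<lceil>real n / real P\<rceil> = int (Suc ?q)"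
    proof (rule ceiling_unique)
      have "?q * P < n" "n \<le> Suc ?q * P"
        unfolding mult_Suc using n mod by linarith+
      then have "real ?q * real P < real n" "real n \<le> real (Suc ?q) * real P"
        unfolding of_nat_mult[symmetric] of_nat_less_iff of_nat_le_iff .
      then show "real_of_int (int (Suc ?q)) - 1 < real n / real P"
        "real n / real P \<le> real_of_int (int (Suc ?q))"
        using P(1) by (simp_all add: field_simps)
    qed
    then have ceil: "nat \<lceil>real n / real P\<rceil> = Suc ?q" by simp
    have last: "min (Suc ?q * P) n - ?q * P = n mod P"
      unfolding mult_Suc using n mod by linarith
    have q: "1 * P \<le> n" "i * P \<le> n" using i by (intro le; simp)+
    let ?d = "min (2 * P) n - P"
    \<comment> \<open>If \<open>?q = 1\<close>, then the second block column is itself the truncated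
      one, of width \<open>n mod P\<close>; otherwise it has full width \<open>P\<close>.\<close>
    have d: "n mod P \<le> ?d"
    proof (cases "?q = 1")
      case True
      then have "P + n mod P = n" using n by (metis mult_1)
      then show ?thesis using mod by linarith
    next
      case False
      then have "2 * P \<le> n" using i by (intro le) simp
      then show ?thesis using mod by simp
    qed
    have B12: "mat_block P Minv 1 2 = mat P ?d (\<lambda>(r, s). Minv $$ (r, P + s))"
      using block[of 1 2] q(1) by simp
    have "left_columns (n mod P) (mat_block P Minv 1 2) =
        mat P (n mod P) (\<lambda>(r, s). Minv $$ (r, P + s))"
      unfolding left_columns_def B12 lessThan_atLeast0
      using d by (subst submatrix_interval) auto
    also have "\<dots> = mat_block P Minv i (Suc ?q)"
      using block[of i "Suc ?q"] i q(2) last by simp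
    finally show "mat_block P Minv i (nat \<lceil>real n / real P\<rceil>) =
        left_columns (n mod P) (mat_block P Minv 1 2)"
      by (simp add: ceil)
  qed
qed

end
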